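(* Let $G$ be a finite, simple, undirected, connected graph of chromatic number $k$. If $G$ contains a cycle of length $k$, then $G$ has a $k$-coloring $f$ such that, for every vertex $u$ of $G$, some full $f$-rainbow path begins at $u$.
   Context: For a positive integer $k$, $[k]=\{1,\dots,k\}$. A $k$-coloring of $G$ is a function $f:V(G)\to[k]$ with $f(u)\neq f(v)$ for every two adjacent vertices $u,v$; the chromatic number is the minimum $k$ for which a $k$-coloring exists. For a $k$-coloring $f$, an $f$-rainbow path is a path in $G$ whose vertices have pairwise distinct colors under $f$; it is full if it has order (number of vertices) $k$. A path begins at $u$ if $u$ is one of its end vertices. *)

theory Defs
  imports Main
begin

definition simple_graph :: "'a set \<Rightarrow> ('a \<Rightarrow> 'a \<Rightarrow> bool) \<Rightarrow> bool" where
  "simple_graph V E \<longleftrightarrow> finite V \<and> (\<forall>u v. E u v \<longrightarrow> u \<in> V \<and> v \<in> V)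
     \<and> (\<forall>u v. E u v \<longrightarrow> E v u) \<and> (\<forall>u. \<not> E u u)"

definition is_path :: "'a set \<Rightarrow> ('a \<Rightarrow> 'a \<Rightarrow> bool) \<Rightarrow> 'a list \<Rightarrow> bool" where
  "is_path V E p \<longleftrightarrow> p \<noteq> [] \<and> set p \<subseteq> V \<and> distinct p
     \<and> (\<forall>i. Suc i < length p \<longrightarrow> E (p ! i) (p ! Suc i))"

definition connected_graph :: "'a set \<Rightarrow> ('a \<Rightarrow> 'a \<Rightarrow> bool) \<Rightarrow> bool" where
  "connected_graph V E \<longleftrightarrow> V \<noteq> {} \<and>
     (\<forall>u\<in>V. \<forall>v\<in>V. \<exists>p. is_path V E p \<and> hd p = u \<and> last p = v)"

definition has_cycle_of_length :: "'a set \<Rightarrow> ('a \<Rightarrow> 'a \<Rightarrow> bool) \<Rightarrow> nat \<Rightarrow> bool" where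
  "has_cycle_of_length V E k \<longleftrightarrow> k \<ge> 3 \<and>
     (\<exists>c. length c = k \<and> is_path V E c \<and> E (last c) (hd c))"

definition is_coloring :: "'a set \<Rightarrow> ('a \<Rightarrow> 'a \<Rightarrow> bool) \<Rightarrow> nat \<Rightarrow> ('a \<Rightarrow> nat) \<Rightarrow> bool" where
  "is_coloring V E k f \<longleftrightarrow> (\<forall>v\<in>V. f v \<in> {1..k}) \<and> (\<forall>u v. E u v \<longrightarrow> f u \<noteq> f v)"

definition chromatic_number :: "'a set \<Rightarrow> ('a \<Rightarrow> 'a \<Rightarrow> bool) \<Rightarrow> nat" where
  "chromatic_number V E = (LEAST k. \<exists>f. is_coloring V E k f)"

definition rainbow_path :: "'a set \<Rightarrow> ('a \<Rightarrow> 'a \<Rightarrow> bool) \<Rightarrow> ('a \<Rightarrow> nat) \<Rightarrow> 'a list \<Rightarrow> bool" where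
  "rainbow_path V E f p \<longleftrightarrow> is_path V E p \<and> distinct (map f p)"

definition full_rainbow_path ::
  "'a set \<Rightarrow> ('a \<Rightarrow> 'a \<Rightarrow> bool) \<Rightarrow> nat \<Rightarrow> ('a \<Rightarrow> nat) \<Rightarrow> 'a list \<Rightarrow> bool" where
  "full_rainbow_path V E k f p \<longleftrightarrow> rainbow_path V E f p \<and> length p = k"

definition path_begins_at :: "'a list \<Rightarrow> 'a \<Rightarrow> bool" where
  "path_begins_at p u \<longleftrightarrow> hd p = u \<or> last p = u"

end

theory Submission
  imports Defs
begin

text \<open>
  Work with colours modulo \<open>k\<close> and orient an edge from \<open>u\<close> to \<open>v\<close> when the colour of \<open>v\<close> is one
  more than that of \<open>u\<close>. If every vertex has an out-neighbour, following out-edges yields full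
  rainbow paths. If \<open>S\<close> has no outgoing arc, raising all colours in \<open>S\<close> by one keeps the colouring
  proper.

  Some colouring has a directed cycle: take a colouring with the largest number of colours on the
  given \<open>k\<close>-cycle \<open>c\<close> and permute colours so that every colour \<open>i\<close> occurring on \<open>c\<close> occurs at the
  \<open>i\<close>-th vertex of \<open>c\<close>. These representatives are then joined by arcs whenever their colours are
  consecutive. If \<open>c\<close> is rainbow, it is a directed cycle. Otherwise some \<open>a\<close> on \<open>c\<close> shares
  the colour of a representative \<open>b \<noteq> a\<close>. Were there no directed cycle, raising either the
  descendants of \<open>b\<close> or the non-ancestors of \<open>b\<close> would separate \<open>a\<close> from \<open>b\<close> and keep all
  representatives and \<open>a\<close> distinctly coloured, contradicting maximality.

  Finally, keep a directed cycle through \<open>z\<close> and raise the colours of all vertices not reaching \<open>z\<close>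
  until one of them gets an arc to a vertex reaching \<open>z\<close>. By connectedness, in the end all do.
\<close>

section \<open>Colourings modulo \<open>k\<close> and raising a set of vertices\<close>

definition proper_mod :: "'a set \<Rightarrow> ('a \<Rightarrow> 'a \<Rightarrow> bool) \<Rightarrow> nat \<Rightarrow> ('a \<Rightarrow> nat) \<Rightarrow> bool" where
  "proper_mod V E k f \<longleftrightarrow> (\<forall>v\<in>V. f v < k) \<and> (\<forall>u v. E u v \<longrightarrow> f u \<noteq> f v)"

definition arcs :: "('a \<Rightarrow> 'a \<Rightarrow> bool) \<Rightarrow> nat \<Rightarrow> ('a \<Rightarrow> nat) \<Rightarrow> ('a \<times> 'a) set" where
  "arcs E k f = {(u, v). E u v \<and> f v = Suc (f u) mod k}"

definition shift :: "'a set \<Rightarrow> nat \<Rightarrow> nat \<Rightarrow> ('a \<Rightarrow> nat) \<Rightarrow> 'a \<Rightarrow> nat" where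
  "shift S k j f v = (if v \<in> S then (f v + j) mod k else f v)"

lemma add_mod_inj:
  fixes x y j k :: nat
  assumes "x < k" "y < k" "(x + j) mod k = (y + j) mod k"
  shows "x = y"
proof -
  have "(int x + int j) mod int k = (int y + int j) mod int k"
    using assms(3) by (metis of_nat_add of_nat_mod)
  then have "(int x + int j - int j) mod int k = (int y + int j - int j) mod int k"
    by (rule mod_diff_cong) (rule refl)
  then show ?thesis using assms by simp
qed

lemma Suc_mod_inj:
  assumes "x < k" "y < k" "Suc x mod k = Suc y mod k"
  shows "x = y"
  using add_mod_inj[of x k y 1] assms by simp

locale finite_simple_graph =
  fixes V :: "'a set" and E :: "'a \<Rightarrow> 'a \<Rightarrow> bool"
  assumes simple: "simple_graph V E"
begin

lemma finite_V: "finite V"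
  and edge_in: "E u v \<Longrightarrow> u \<in> V \<and> v \<in> V"
  and edge_sym: "E u v \<Longrightarrow> E v u"
  using simple unfolding simple_graph_def by blast+

text \<open>Adding \<open>j\<close> modulo \<open>k\<close> is injective, so edges inside
  \<open>S\<close> stay proper; symmetry of \<open>E\<close> lets one condition cover crossing edges
  in both directions. For \<open>j = 1\<close> it says that no arc leaves \<open>S\<close>.\<close>

lemma proper_mod_shift:
  assumes f: "proper_mod V E k f" and "k > 0"
    and S: "\<And>u v. E u v \<Longrightarrow> u \<in> S \<Longrightarrow> v \<notin> S \<Longrightarrow> (f u + j) mod k \<noteq> f v"
  shows "proper_mod V E k (shift S k j f)"
proof -
  have "shift S k j f u \<noteq> shift S k j f v" if e: "E u v" for u v
  proof -
    have "f u \<noteq> f v" "f u < k" "f v < k"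
      using f e edge_in[OF e] by (auto simp: proper_mod_def)
    then show ?thesis
      using S[OF e] S[OF edge_sym[OF e]] add_mod_inj[of "f u" k "f v" j]
      by (auto simp: shift_def)
  qed
  then show ?thesis using f \<open>k > 0\<close> by (auto simp: proper_mod_def shift_def)
qed

text \<open>An injective numbering of \<open>V\<close> is a colouring, so the \<open>LEAST\<close>
  is attained.\<close>

lemma chromatic_coloring_exists: "\<exists>f. is_coloring V E (chromatic_number V E) f"
proof -
  obtain g :: "'a \<Rightarrow> nat" where g: "bij_betw g V {1..card V}"
    using ex_bij_betw_finite_nat[OF finite_V] ex_bij_betw_nat_finite_1[OF finite_V]
      bij_betw_inv_into by blast
  have "g u \<noteq> g v" if "E u v" for u v
    using g edge_in[OF that] that simple
    by (metis bij_betw_def inj_onD simple_graph_def)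
  then have "is_coloring V E (card V) g"
    using g by (auto simp: is_coloring_def bij_betw_def)
  then show ?thesis
    unfolding chromatic_number_def by (rule LeastI[of "\<lambda>k. \<exists>f. is_coloring V E k f", OF exI])
qed

section \<open>A colouring with a directed cycle\<close>

lemma normalize_on_cycle:
  assumes f: "proper_mod V E k f" and c: "length c = k" "set c \<subseteq> V"
  obtains g where "proper_mod V E k g" "card (g ` set c) = card (f ` set c)"
    "\<And>v. v \<in> set c \<Longrightarrow> g (c ! g v) = g v"
proof -
  define A where "A = f ` set c"
  define h where "h i = (LEAST j. j < k \<and> f (c ! j) = i)" for i
  have h: "h i < k \<and> f (c ! h i) = i" if "i \<in> A" for i
  proof -
    have "\<exists>j. j < k \<and> f (c ! j) = i"
      using that c by (auto simp: A_def in_set_conv_nth)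
    then show ?thesis unfolding h_def by (rule LeastI_ex)
  qed
  have inj_h: "inj_on h A" by (metis h inj_onI)
  have A: "A \<subseteq> {..<k}" using f c by (auto simp: A_def proper_mod_def)
  have hA: "h ` A \<subseteq> {..<k}" using h by auto
  \<comment> \<open>\<open>h\<close> sends a colour to its first position on \<open>c\<close>;
    matching the leftover colours with the leftover positions extends it to a permutation.\<close>
  have "card ({..<k} - A) = card ({..<k} - h ` A)"
    using A hA inj_h by (simp add: card_Diff_subset finite_subset card_image)
  then obtain h' where h': "bij_betw h' ({..<k} - A) ({..<k} - h ` A)"
    using finite_same_card_bij by blast
  define p where "p i = (if i \<in> A then h i else h' i)" for i
  have "bij_betw p (A \<union> ({..<k} - A)) (h ` A \<union> ({..<k} - h ` A))"
  proof (rule bij_betw_combine)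
    show "bij_betw p A (h ` A)"
      using inj_h by (auto simp: bij_betw_def p_def inj_on_def)
    show "bij_betw p ({..<k} - A) ({..<k} - h ` A)"
      using h' by (rule bij_betw_cong[THEN iffD1, rotated]) (simp add: p_def)
  qed auto
  then have p: "bij_betw p {..<k} {..<k}" using A hA by (simp add: Un_absorb1 Un_Diff_cancel)
  show ?thesis
  proof
    show "proper_mod V E k (p \<circ> f)"
      unfolding proper_mod_def
    proof (intro conjI ballI allI impI)
      show "(p \<circ> f) v < k" if "v \<in> V" for v
        using that f p by (auto simp: proper_mod_def bij_betw_def)
      show "(p \<circ> f) u \<noteq> (p \<circ> f) v" if e: "E u v" for u v
        using f edge_in[OF e] e inj_onD[OF bij_betw_imp_inj_on[OF p], of "f u" "f v"]
        by (auto simp: proper_mod_def)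
    qed
    have "inj_on p A" using p A by (auto simp: bij_betw_def intro: inj_on_subset)
    then show "card ((p \<circ> f) ` set c) = card (f ` set c)"
      using card_image[of p A] by (simp add: A_def image_image)
    show "(p \<circ> f) (c ! (p \<circ> f) v) = (p \<circ> f) v" if "v \<in> set c" for v
      using h[of "f v"] that by (simp add: p_def A_def)
  qed
qed

text \<open>The representatives alone already show every colour on \<open>c\<close>; raising a
  suitable set keeps them distinct and gives \<open>a\<close> a further colour.\<close>

lemma more_colors_on_cycle:
  assumes f: "proper_mod V E k f" and c: "length c = k" "set c \<subseteq> V"
    and cyc: "\<And>i. i < k \<Longrightarrow> E (c ! i) (c ! (Suc i mod k))"
    and norm: "\<And>v. v \<in> set c \<Longrightarrow> f (c ! f v) = f v"
    and acyclic: "acyclic (arcs E k f)"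
    and a: "a \<in> set c" "a \<noteq> c ! f a"
  obtains g where "proper_mod V E k g" "card (g ` set c) > card (f ` set c)"
proof -
  define D where "D = arcs E k f"
  have "k > 0" using a c by auto
  have lt: "f v < k" if "v \<in> set c" for v using f c that by (auto simp: proper_mod_def)
  have D_acyc: "(u, v) \<in> D\<^sup>* \<Longrightarrow> (v, u) \<notin> D" for u v
    using acyclic unfolding D_def acyclic_def by (meson rtrancl_into_trancl1)
  define T where "T = (\<lambda>v. c ! f v) ` set c"
  have T: "y \<in> set c" "c ! f y = y" if "y \<in> T" for y
    using that lt c norm by (auto simp: T_def)
  have fT: "f ` T = f ` set c"
    unfolding T_def image_image using norm by (rule image_cong[OF refl])
  have T_inj: "y = z" if "y \<in> T" "z \<in> T" "f y = f z" for y z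
    using that T by metis
  \<comment> \<open>Each \<open>y\<close> sits at position \<open>f y\<close> of \<open>c\<close>,
    so consecutive colours mean cyclically neighbouring positions.\<close>
  have T_arc: "(y, z) \<in> D" if "y \<in> T" "z \<in> T" "f z = Suc (f y) mod k" for y z
    using cyc[of "f y"] T[OF that(1)] T[OF that(2)] that(3) lt[of y]
    by (auto simp: D_def arcs_def)
  define b where "b = c ! f a"
  have b: "b \<in> T" "f b = f a" using a norm by (auto simp: b_def T_def)
  obtain S where S: "\<And>u v. (u, v) \<in> D \<Longrightarrow> u \<in> S \<Longrightarrow> v \<in> S"
    and sep: "a \<in> S \<longleftrightarrow> b \<notin> S"
    and pred: "\<And>y. (y, b) \<in> D \<Longrightarrow> y \<notin> S"
    and succ: "\<And>y. (b, y) \<in> D \<Longrightarrow> y \<in> S"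
  \<comment> \<open>By acyclicity the descendants of \<open>b\<close> contain none of its
    in-neighbours, and the non-ancestors contain all its out-neighbours.\<close>
  proof (cases "(a, b) \<in> D\<^sup>*")
    case True
    have "(b, a) \<notin> D\<^sup>*"
      using True acyclic a unfolding D_def b_def
      by (metis acyclic_impl_antisym_rtrancl antisymD)
    then show ?thesis
      using D_acyc by (intro that[of "{v. (b, v) \<in> D\<^sup>*}"]) (auto intro: rtrancl_into_rtrancl)
  next
    case False
    then show ?thesis
      using D_acyc by (intro that[of "{v. (v, b) \<notin> D\<^sup>*}"]) (auto intro: converse_rtrancl_into_rtrancl)
  qed
  define g where "g = shift S k 1 f"
  have g: "g v = (if v \<in> S then Suc (f v) mod k else f v)" for v
    by (simp add: g_def shift_def)
  have "proper_mod V E k g"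
    unfolding g_def
  proof (rule proper_mod_shift[OF f \<open>k > 0\<close>])
    show "(f u + 1) mod k \<noteq> f v" if "E u v" "u \<in> S" "v \<notin> S" for u v
      using S[of u v] that by (auto simp: D_def arcs_def)
  qed
  moreover have "card (f ` set c) < card (g ` set c)"
  proof -
    have "inj_on g T"
    proof (rule inj_onI)
      fix y z assume yz: "y \<in> T" "z \<in> T" "g y = g z"
      \<comment> \<open>A collision across the boundary would be an arc leaving
        \<open>S\<close>.\<close>
      have "y \<in> S \<longleftrightarrow> z \<in> S"
        using T_arc[OF yz(1,2)] T_arc[OF yz(2,1)] S[of y z] S[of z y] yz(3)
        by (auto simp: g split: if_splits)
      then have "f y = f z"
        using yz(3) Suc_mod_inj[OF lt lt, OF T(1) T(1), OF yz(1,2)] by (auto simp: g split: if_splits)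
      then show "y = z" using T_inj yz by blast
    qed
    moreover have "g a \<notin> g ` T"
    proof
      assume "g a \<in> g ` T"
      then obtain y where y: "y \<in> T" "g y = g a" by auto
      have ly: "f y < k" "f a < k" using y T lt a by auto
      show False
      proof (cases "a \<in> S \<longleftrightarrow> y \<in> S")
        case True
        then have "f y = f b"
          using y(2) Suc_mod_inj[OF ly] b(2) by (auto simp: g split: if_splits)
        then show False using T_inj[OF y(1) b(1)] sep True by auto
      next
        case False
        \<comment> \<open>As \<open>f a = f b\<close>, a collision across the boundary makes the
          colours of \<open>y\<close> and \<open>b\<close> consecutive; the resulting arc
          contradicts \<open>pred\<close> or \<open>succ\<close>.\<close>
        then show False
          using y b sep pred[of y] succ[of y] T_arc[OF y(1) b(1)] T_arc[OF b(1) y(1)]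
          by (auto simp: g split: if_splits)
      qed
    qed
    moreover have "finite T" by (simp add: T_def)
    ultimately have "card (g ` insert a T) = Suc (card T)"
      by (simp add: card_image)
    moreover have "card T = card (f ` set c)"
      using fT T_inj by (metis card_image inj_onI)
    moreover have "card (g ` insert a T) \<le> card (g ` set c)"
      using T(1) a by (intro card_mono) auto
    ultimately show ?thesis by simp
  qed
  ultimately show ?thesis by (rule that)
qed

lemma cyclic_arcs_exist:
  assumes f0: "proper_mod V E k f0" and c: "length c = k" "set c \<subseteq> V" "k > 0" "distinct c"
    and cyc: "\<And>i. i < k \<Longrightarrow> E (c ! i) (c ! (Suc i mod k))"
  obtains f z where "proper_mod V E k f" "(z, z) \<in> (arcs E k f)\<^sup>+"
proof -
  have "card (f ` set c) < Suc (length c)" for f :: "'a \<Rightarrow> nat"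
    using card_image_le[of "set c" f] card_length[of c] by simp
  then have "\<exists>f. proper_mod V E k f \<and>
      (\<forall>g. proper_mod V E k g \<longrightarrow> card (g ` set c) \<le> card (f ` set c))"
    by (intro ex_has_greatest_nat[of "proper_mod V E k" f0]) (use f0 in blast)+
  then obtain f1 where f1: "proper_mod V E k f1"
    and max1: "\<And>g. proper_mod V E k g \<Longrightarrow> card (g ` set c) \<le> card (f1 ` set c)"
    by blast
  obtain f where f: "proper_mod V E k f" and card_f: "card (f ` set c) = card (f1 ` set c)"
    and norm: "\<And>v. v \<in> set c \<Longrightarrow> f (c ! f v) = f v"
    using normalize_on_cycle[OF f1 c(1,2)] by blast
  have "\<not> acyclic (arcs E k f)"
  proof
    assume acyc: "acyclic (arcs E k f)"
    have rep: "a = c ! f a" if "a \<in> set c" for a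
      using more_colors_on_cycle[OF f c(1,2) cyc norm acyc that] max1 card_f
      by (metis not_less)
    \<comment> \<open>Every vertex of \<open>c\<close> now represents its own colour and
      \<open>c\<close> is distinct, so colour and position agree and \<open>c\<close> itself is a
      directed cycle.\<close>
    have col: "f (c ! i) = i" if "i < k" for i
    proof -
      have "c ! i \<in> set c" using that c by simp
      moreover from this have "f (c ! i) < k" using f c by (auto simp: proper_mod_def)
      ultimately show ?thesis
        using rep[of "c ! i"] that c by (metis nth_eq_iff_index_eq)
    qed
    have arc: "(c ! i, c ! (Suc i mod k)) \<in> arcs E k f" if "i < k" for i
      using cyc[OF that] col that c by (simp add: arcs_def)
    have "(c ! 0, c ! i) \<in> (arcs E k f)\<^sup>*" if "i < k" for i
      using that
    proof (induction i)
      case (Suc i)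
      then show ?case using arc[of i] by (auto intro: rtrancl_into_rtrancl)
    qed simp
    from this[of "k - 1"] arc[of "k - 1"] have "(c ! 0, c ! 0) \<in> (arcs E k f)\<^sup>+"
      using \<open>k > 0\<close> by (auto intro: rtrancl_into_trancl1)
    then show False using acyc by (simp add: acyclic_def)
  qed
  then show ?thesis using that f by (auto simp: acyclic_def)
qed

section \<open>Making every vertex reach the directed cycle\<close>

lemma crossing_edge:
  assumes conn: "connected_graph V E" and "r \<in> R" "r \<in> V" "s \<in> V" "s \<notin> R"
  obtains u v where "E u v" "u \<notin> R" "v \<in> R"
proof -
  obtain p where p: "is_path V E p" "hd p = s" "last p = r"
    using conn assms unfolding connected_graph_def by blast
  define i where "i = (LEAST i. i < length p \<and> p ! i \<in> R)"
  have "length p - 1 < length p \<and> p ! (length p - 1) \<in> R"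
    using p \<open>r \<in> R\<close> by (auto simp: is_path_def last_conv_nth)
  then have i: "i < length p \<and> p ! i \<in> R" unfolding i_def by (rule LeastI)
  have "i \<noteq> 0" using i p \<open>s \<notin> R\<close> by (metis hd_conv_nth is_path_def)
  then obtain j where j: "i = Suc j" by (cases i) auto
  then have "p ! j \<notin> R"
    using i not_less_Least[of j "\<lambda>i. i < length p \<and> p ! i \<in> R"] by (auto simp: i_def)
  moreover have "E (p ! j) (p ! Suc j)" using p i j by (simp add: is_path_def)
  ultimately show ?thesis using that i j by blast
qed

lemma enlarge_reaching_set:
  assumes conn: "connected_graph V E" and f: "proper_mod V E k f"
    and z: "(z, z) \<in> (arcs E k f)\<^sup>+" and s: "s \<in> V" "(s, z) \<notin> (arcs E k f)\<^sup>*"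
  obtains g where "proper_mod V E k g" "(z, z) \<in> (arcs E k g)\<^sup>+"
    "{u. (u, z) \<in> (arcs E k f)\<^sup>*} \<subset> {u. (u, z) \<in> (arcs E k g)\<^sup>*}"
proof -
  define R where "R = {u. (u, z) \<in> (arcs E k f)\<^sup>*}"
  have zR: "z \<in> R" by (simp add: R_def)
  have zV: "z \<in> V"
    using z edge_in by (induction rule: trancl_induct) (auto simp: arcs_def)
  have "k > 0" using f zV by (auto simp: proper_mod_def)
  \<comment> \<open>\<open>P j\<close> says that raising the complement of \<open>R\<close> by
    \<open>Suc j\<close> makes a crossing edge monochromatic. For the least such \<open>j\<close>,
    raising by \<open>j\<close> is still proper and turns that edge into an arc.\<close>
  define P where "P j \<longleftrightarrow> (\<exists>u v. E u v \<and> u \<notin> R \<and> v \<in> R \<and> (f u + Suc j) mod k = f v)" for j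
  have "\<exists>j. P j"
  proof -
    obtain u v where uv: "E u v" "u \<notin> R" "v \<in> R"
      using crossing_edge[OF conn zR zV s(1)] s(2) by (auto simp: R_def)
    then have "f u < k" "f v < k" using f edge_in by (auto simp: proper_mod_def)
    \<comment> \<open>The witness makes the sum equal to \<open>k + f v\<close>.\<close>
    then have "(f u + Suc (k - 1 - f u + f v)) mod k = f v" by simp
    then show ?thesis using uv P_def by blast
  qed
  define j where "j = (LEAST j. P j)"
  have "P j" using \<open>\<exists>j. P j\<close> unfolding j_def by (rule LeastI_ex)
  define g where "g = shift (- R) k j f"
  have gR: "g v = f v" if "v \<in> R" for v using that by (simp add: g_def shift_def)
  have "proper_mod V E k g"
    unfolding g_def
  proof (rule proper_mod_shift[OF f \<open>k > 0\<close>])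
    fix u v assume uv: "E u v" "u \<in> - R" "v \<notin> - R"
    show "(f u + j) mod k \<noteq> f v"
    proof (cases j)
      case 0
      then show ?thesis using f uv edge_in[OF uv(1)] by (auto simp: proper_mod_def)
    next
      case (Suc i)
      then have "\<not> P i" using not_less_Least[of i P] by (simp add: j_def)
      then show ?thesis using uv Suc by (auto simp: P_def)
    qed
  qed
  \<comment> \<open>Directed paths to \<open>z\<close> stay inside \<open>R\<close>, where colours
    are unchanged.\<close>
  have keep: "(u, z) \<in> (arcs E k g)\<^sup>*" if "(u, z) \<in> (arcs E k f)\<^sup>*" for u
    using that
  proof (induction rule: converse_rtrancl_induct)
    case (step u w)
    then have "u \<in> R" "w \<in> R" by (auto simp: R_def intro: converse_rtrancl_into_rtrancl)
    then have "(u, w) \<in> arcs E k g" using step(1) by (simp add: arcs_def gR)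
    then show ?case using step(3) by (rule converse_rtrancl_into_rtrancl)
  qed simp
  obtain w where w: "(z, w) \<in> arcs E k f" "(w, z) \<in> (arcs E k f)\<^sup>*"
    using z by (meson tranclD)
  then have "(z, w) \<in> arcs E k g"
    using zR by (simp add: arcs_def gR R_def)
  then have "(z, z) \<in> (arcs E k g)\<^sup>+" using keep[OF w(2)] by (rule rtrancl_into_trancl2)
  obtain u v where uv: "E u v" "u \<notin> R" "v \<in> R" "(f u + Suc j) mod k = f v"
    using \<open>P j\<close> P_def by blast
  then have "(u, v) \<in> arcs E k g"
    by (simp add: arcs_def gR) (simp add: g_def shift_def mod_Suc_eq)
  then have "(u, z) \<in> (arcs E k g)\<^sup>*"
    using keep[of v] uv(3) by (auto simp: R_def intro: converse_rtrancl_into_rtrancl)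
  then have "R \<subset> {u. (u, z) \<in> (arcs E k g)\<^sup>*}"
    using uv(2) keep by (auto simp: R_def)
  then show ?thesis
    using that \<open>proper_mod V E k g\<close> \<open>(z, z) \<in> (arcs E k g)\<^sup>+\<close> by (simp add: R_def)
qed

text \<open>Among the colourings with \<open>z\<close> on a directed cycle, one with the most
  vertices reaching \<open>z\<close> admits no enlargement.\<close>

lemma all_vertices_have_out_arc:
  assumes conn: "connected_graph V E" and f0: "proper_mod V E k f0"
    and z0: "(z, z) \<in> (arcs E k f0)\<^sup>+"
  obtains f where "proper_mod V E k f" "\<And>u. u \<in> V \<Longrightarrow> \<exists>v. (u, v) \<in> arcs E k f"
proof -
  define Q where "Q f \<longleftrightarrow> proper_mod V E k f \<and> (z, z) \<in> (arcs E k f)\<^sup>+" for f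
  define R where "R f = {u. (u, z) \<in> (arcs E k f)\<^sup>*}" for f
  have zV: "z \<in> V"
    using z0 edge_in by (induction rule: trancl_induct) (auto simp: arcs_def)
  have RV: "R f \<subseteq> V" for f
    using zV edge_in by (auto simp: R_def arcs_def elim: converse_rtranclE)
  then have finR: "finite (R f)" and "card (R f) < Suc (card V)" for f
    using finite_V by (auto intro: finite_subset simp: card_mono less_Suc_eq_le)
  moreover have "Q f0" using f0 z0 by (simp add: Q_def)
  ultimately have "\<exists>f. Q f \<and> (\<forall>g. Q g \<longrightarrow> card (R g) \<le> card (R f))"
    by (intro ex_has_greatest_nat[of Q f0]) blast+
  then obtain f where f: "Q f" and max: "\<And>g. Q g \<Longrightarrow> card (R g) \<le> card (R f)"
    by blast
  have reach: "(u, z) \<in> (arcs E k f)\<^sup>*" if u: "u \<in> V" for u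
  proof (rule ccontr)
    assume not_reach: "(u, z) \<notin> (arcs E k f)\<^sup>*"
    have "proper_mod V E k f" "(z, z) \<in> (arcs E k f)\<^sup>+"
      using f by (auto simp: Q_def)
    from enlarge_reaching_set[OF conn this u not_reach]
    obtain g where g: "Q g" "R f \<subset> R g" by (metis Q_def R_def)
    show False using max[OF g(1)] psubset_card_mono[OF finR g(2)] by simp
  qed
  \<comment> \<open>The out-arc starts the path to \<open>z\<close>, or the cycle if
    \<open>u = z\<close>.\<close>
  have "\<exists>v. (u, v) \<in> arcs E k f" if "u \<in> V" for u
    using reach[OF that] f unfolding Q_def by (metis converse_rtranclE tranclD)
  then show ?thesis using that f by (auto simp: Q_def)
qed

section \<open>From out-arcs to full rainbow paths\<close>

lemma full_rainbow_path_from_out_arcs: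
  assumes f: "proper_mod V E k f" and out: "\<And>u. u \<in> V \<Longrightarrow> \<exists>v. (u, v) \<in> arcs E k f"
    and u: "u \<in> V"
  obtains p where "full_rainbow_path V E k (\<lambda>v. Suc (f v)) p" "hd p = u"
proof -
  have "k > 0" using f u by (auto simp: proper_mod_def)
  obtain nxt where nxt: "\<And>v. v \<in> V \<Longrightarrow> (v, nxt v) \<in> arcs E k f" using out by metis
  define w where "w i = (nxt ^^ i) u" for i
  have w0: "w 0 = u" by (simp add: w_def)
  have wV: "w i \<in> V" for i
    by (induction i) (use u nxt edge_in in \<open>auto simp: w_def arcs_def\<close>)
  have step: "(w i, w (Suc i)) \<in> arcs E k f" for i
    using nxt[OF wV[of i]] by (simp add: w_def)
  \<comment> \<open>Colours rise by one along the walk, so its first \<open>k\<close> vertices have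
    distinct colours and are therefore distinct.\<close>
  have col: "f (w i) = (i + f u) mod k" for i
  proof (induction i)
    case 0
    then show ?case using f u by (simp add: w_def proper_mod_def)
  next
    case (Suc i)
    then show ?case using step[of i] by (simp add: arcs_def mod_Suc_eq)
  qed
  define p where "p = map w [0..<k]"
  have dist: "distinct (map (\<lambda>v. Suc (f v)) p)"
    using add_mod_inj by (auto simp: p_def distinct_map inj_on_def col)
  then have "distinct p" by (simp add: distinct_map)
  then have "is_path V E p"
    using \<open>k > 0\<close> wV step by (auto simp: is_path_def p_def arcs_def)
  then have "full_rainbow_path V E k (\<lambda>v. Suc (f v)) p"
    using dist by (simp add: full_rainbow_path_def rainbow_path_def p_def)
  moreover have "hd p = u" using \<open>k > 0\<close> w0 by (simp add: p_def hd_map)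
  ultimately show ?thesis by (rule that)
qed

end

theorem theorem3:
  fixes V :: "'a set" and E :: "'a \<Rightarrow> 'a \<Rightarrow> bool" and k :: nat
  assumes "simple_graph V E"
    and "connected_graph V E"
    and "chromatic_number V E = k"
    and "has_cycle_of_length V E k"
  shows "\<exists>f. is_coloring V E k f \<and>
           (\<forall>u\<in>V. \<exists>p. full_rainbow_path V E k f p \<and> path_begins_at p u)"
proof -
  interpret finite_simple_graph V E by unfold_locales (rule assms(1))
  obtain c where "k \<ge> 3" and c: "length c = k" "is_path V E c" "E (last c) (hd c)"
    using assms(4) by (auto simp: has_cycle_of_length_def)
  have cyc: "E (c ! i) (c ! (Suc i mod k))" if "i < k" for i
  proof (cases "Suc i = k")
    case True
    then have "last c = c ! i" "hd c = c ! 0"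
      using c by (auto simp: is_path_def last_conv_nth hd_conv_nth)
    then show ?thesis using c True by simp
  next
    case False
    then show ?thesis using c that by (simp add: is_path_def)
  qed
  obtain f0 where f0: "is_coloring V E k f0"
    using chromatic_coloring_exists assms(3) by auto
  \<comment> \<open>Colours \<open>{1..k}\<close> become residues; truncated subtraction stays
    injective on them, as they are at least 1.\<close>
  have "proper_mod V E k (\<lambda>v. f0 v - 1)"
    unfolding proper_mod_def
  proof (intro conjI ballI allI impI)
    show "f0 v - 1 < k" if "v \<in> V" for v
      using f0 that \<open>k \<ge> 3\<close> by (fastforce simp: is_coloring_def)
    show "f0 u - 1 \<noteq> f0 v - 1" if e: "E u v" for u v
    proof -
      have "f0 u \<ge> 1" "f0 v \<ge> 1" "f0 u \<noteq> f0 v"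
        using f0 e edge_in[OF e] by (auto simp: is_coloring_def)
      then show ?thesis by linarith
    qed
  qed
  then obtain f1 z where "proper_mod V E k f1" "(z, z) \<in> (arcs E k f1)\<^sup>+"
    using cyclic_arcs_exist[OF _ c(1) _ _ _ cyc] c \<open>k \<ge> 3\<close> by (auto simp: is_path_def)
  then obtain f where f: "proper_mod V E k f"
    and out: "\<And>u. u \<in> V \<Longrightarrow> \<exists>v. (u, v) \<in> arcs E k f"
    using all_vertices_have_out_arc[OF assms(2)] by blast
  have "is_coloring V E k (\<lambda>v. Suc (f v))"
    using f by (auto simp: proper_mod_def is_coloring_def Suc_le_eq)
  then show ?thesis
    using full_rainbow_path_from_out_arcs[OF f out] unfolding path_begins_at_def by metis
qed

end
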